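(* Let $m=m_N\ge1$ and $k=k_N\ge1$ be sequences of integers with $m_N=o(N)$ and $k_N=o(N)$, and let $(R_N)$ be a sequence of nonnegative real numbers with $R_N=o(N^{1/2})$. Let $g_N$ be the density of $\sqrt{N}Z_N$, where $Z_N$ is the upper-left $m\times k$ block of a Haar-distributed matrix in $\mathcal{O}(N)$, in the explicit version given in the context, and let $\phi_N$ be the density of an $m\times k$ matrix with i.i.d. standard Gaussian entries. Then there exists a constant $C>0$ such that for all sufficiently large $N$, $$\sup_{B\in\mathbb{R}^{m\times k}:\ \|B\|_F\le R_N}\left|\log\frac{g_N(B)}{\phi_N(B)}\right|\le C\left(\frac{R_N^4}{N}+\frac{mk(m+k)}{N}+\frac{(k+m)R_N^2}{N}\right).$$
   Context: $\mathcal{O}(N)$ is the group of real orthogonal $N\times N$ matrices; $\|\cdot\|_F$ is the Frobenius norm and $\|\cdot\|_{op}$ the operator norm. For $N\ge m+k$, the upper-left $m\times k$ block $Z_N$ of a Haar-distributed matrix in $\mathcal{O}(N)$ has density $$f_N(A)=\frac{\Gamma_m\left(\frac N2\right)}{\pi^{\frac{mk}{2}}\,\Gamma_m\left(\frac{N-k}{2}\right)}\det\left(\operatorname{Id}_m-AA^\top\right)^{\frac{N-k-m-1}{2}}\mathbf{1}_{\{\|AA^\top\|_{op}<1\}}$$ on $m\times k$ real matrices (supported in $[-1,1]^{m\times k}$), where $\Gamma_m(x)=\pi^{\frac{m(m-1)}{4}}\prod_{i=1}^m\Gamma\left(x-\frac{i-1}{2}\right)$, $x>\frac12(m-1)$,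 is the multivariate gamma function. For $B\in\mathbb{R}^{m\times k}$, $$g_N(B):=N^{-\frac{mk}{2}}f_N\left(\frac{B}{\sqrt N}\right),\qquad \phi_N(B):=(2\pi)^{-\frac{mk}{2}}\exp\left(-\frac12\|B\|_F^2\right).$$ *)

theory Defs
  imports
    "HOL-Analysis.Gamma_Function"
    "HOL-Analysis.L2_Norm"
    "HOL-Library.Extended_Real"
    "HOL-Library.Landau_Symbols"
    "Jordan_Normal_Form.Determinant"
begin

text \<open>
  The dimensions of the matrices vary with \<open>N\<close>, so they are taken from the type
  \<^typ>\<open>real mat\<close> with explicit carriers \<open>carrier_mat m k\<close>.
\<close>

definition vec_norm2 :: "real vec \<Rightarrow> real" where
  "vec_norm2 v = L2_set (\<lambda>i. vec_index v i) {..<dim_vec v}"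

definition frobenius_norm :: "real mat \<Rightarrow> real" where
  "frobenius_norm A = L2_set (\<lambda>ij. A $$ ij) ({..<dim_row A} \<times> {..<dim_col A})"

definition mat_op_norm :: "real mat \<Rightarrow> real" where
  "mat_op_norm A =
    (SUP v \<in> {v \<in> carrier_vec (dim_col A). vec_norm2 v \<le> 1}. vec_norm2 (A *\<^sub>v v))"

text \<open>The multivariate gamma function, meaningful for \<open>x > (m - 1) / 2\<close>.\<close>

definition multi_Gamma :: "nat \<Rightarrow> real \<Rightarrow> real" where
  "multi_Gamma m x =
    pi powr (real m * (real m - 1) / 4) * (\<Prod>i = 1..m. Gamma (x - (real i - 1) / 2))"

text \<open>
  The density of the upper-left \<open>m \<times> k\<close> block of a Haar-distributed matrix in \<open>O(N)\<close>.
  It is meaningful for \<open>N \<ge> m + k\<close> and \<open>A \<in> carrier_mat m k\<close>.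
\<close>

definition haar_block_density :: "nat \<Rightarrow> nat \<Rightarrow> nat \<Rightarrow> real mat \<Rightarrow> real" where
  "haar_block_density N m k A =
    multi_Gamma m (real N / 2)
      / (pi powr (real m * real k / 2) * multi_Gamma m ((real N - real k) / 2))
    * det (1\<^sub>m m - A * transpose_mat A) powr ((real N - real k - real m - 1) / 2)
    * of_bool (mat_op_norm (A * transpose_mat A) < 1)"

text \<open>The density of \<open>sqrt N\<close> times that block.\<close>

definition scaled_block_density :: "nat \<Rightarrow> nat \<Rightarrow> nat \<Rightarrow> real mat \<Rightarrow> real" where
  "scaled_block_density N m k B =
    real N powr (- (real m * real k / 2))
    * haar_block_density N m k ((1 / sqrt (real N)) \<cdot>\<^sub>m B)"

definition gaussian_density :: "nat \<Rightarrow> nat \<Rightarrow> real mat \<Rightarrow> real" where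
  "gaussian_density m k B =
    (2 * pi) powr (- (real m * real k / 2)) * exp (- (1 / 2) * (frobenius_norm B)\<^sup>2)"

text \<open>
  The logarithm with \<open>log 0 = - \<infinity>\<close>. Since \<^term>\<open>ln 0 = (0::real)\<close> in HOL, a bound on
  \<^term>\<open>\<bar>ln x\<bar>\<close> alone would say nothing at points where a density vanishes.
\<close>

definition ext_ln :: "real \<Rightarrow> ereal" where
  "ext_ln x = (if x > 0 then ereal (ln x) else - \<infinity>)"

end

theory Submission
  imports Defs "Jordan_Normal_Form.Schur_Decomposition"
begin

text \<open>
  The estimate is in fact non-asymptotic: it holds with constant \<open>2\<close> as soon as
  \<open>2 (m + k + 1) \<le> N\<close> and \<open>2 \<parallel>B\<parallel>\<^sup>2 \<le> N\<close> in the Frobenius norm, and the growth assumptions make both true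
  for large \<open>N\<close>. Write \<open>t = \<parallel>B\<parallel>\<^sup>2 / N\<close>, \<open>A = B / sqrt N\<close> and \<open>D = det (1 - A A\<^sup>T)\<close>. The
  logarithm of the ratio of the densities splits into the contribution of the normalising constants
  and \<open>((N - k - m - 1) / 2) ln D + N t / 2\<close>.

  For the second part, the eigenvalues of \<open>A A\<^sup>T\<close> are nonnegative and add up to \<open>t\<close>, so that
  \<open>1 - t \<le> D \<le> exp (- t)\<close> (\<open>det_one_minus_gram_bounds\<close>) and therefore \<open>ln D = - t + O(t\<^sup>2)\<close>. The
  quadratic error, multiplied by \<open>N\<close>, gives the term \<open>\<parallel>B\<parallel>\<^sup>4 / N\<close>; the linear terms cancel up to
  \<open>(k + m + 1) t / 2\<close>, which gives the term \<open>(k + m) \<parallel>B\<parallel>\<^sup>2 / N\<close>.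

  For the constants, the ratio of the multivariate Gamma functions is a product of \<open>m\<close> quotients
  \<open>Gamma (y + k/2) / Gamma y\<close> in which \<open>y = N/2 + O(m + k)\<close>. Log-convexity of Gamma, together
  with its functional equation, places the logarithm of each quotient between
  \<open>(k/2) ln (y - 1)\<close> and \<open>(k/2) ln (y + k/2)\<close> (\<open>ln_Gamma_increment_bounds\<close>). Both are
  \<open>(k/2) ln (N/2) + O(k (m + k) / N)\<close>, and the \<open>m\<close> errors add up to the term
  \<open>m k (m + k) / N\<close>.
\<close>

section \<open>Determinant and trace through eigenvalues\<close>

lemma sum_list_diag_mat_mult_commute:
  fixes A B :: "'a :: comm_semiring_0 mat"
  assumes "A \<in> carrier_mat n k" "B \<in> carrier_mat k n"
  shows "sum_list (diag_mat (A * B)) = sum_list (diag_mat (B * A))"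
proof -
  have "sum_list (diag_mat (A * B)) = (\<Sum>i<n. \<Sum>l<k. A $$ (i,l) * B $$ (l,i))"
    using assms by (auto simp: diag_mat_def scalar_prod_def interv_sum_list_conv_sum_set_nat
        atLeast0LessThan intro!: sum.cong)
  also have "\<dots> = (\<Sum>l<k. \<Sum>i<n. B $$ (l,i) * A $$ (i,l))"
    by (subst sum.swap) (simp add: mult.commute)
  also have "\<dots> = sum_list (diag_mat (B * A))"
    using assms by (auto simp: diag_mat_def scalar_prod_def interv_sum_list_conv_sum_set_nat
        atLeast0LessThan intro!: sum.cong)
  finally show ?thesis .
qed

text \<open>
  A Schur triangularisation \<open>M = P B P\<^sup>-\<^sup>1\<close> has the eigenvalues of \<open>M\<close>, with multiplicity, on the
  diagonal of \<open>B\<close>; determinant and trace are then read off from \<open>B\<close>, since both are invariant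
  under conjugation.
\<close>

lemma complex_mat_eigenvalue_list:
  fixes M :: "complex mat"
  assumes M: "M \<in> carrier_mat n n"
  obtains es where "\<And>e. e \<in> set es \<Longrightarrow> eigenvalue M e"
    "det (1\<^sub>m n - M) = (\<Prod>e\<leftarrow>es. 1 - e)"
    "sum_list (diag_mat M) = sum_list es"
proof -
  obtain as where "char_poly M = (\<Prod>a\<leftarrow>as. [:- a, 1:])"
    using char_poly_factorized[OF M] by blast
  from schur_decomposition_exists[OF M this] obtain B where
    B: "B \<in> carrier_mat n n" and ut: "upper_triangular B" and sim: "similar_mat M B" by blast
  from sim obtain P Q where wit: "similar_mat_wit M B P Q"
    unfolding similar_mat_def by blast
  note W = similar_mat_witD2[OF M wit]
  show ?thesis
  proof
    fix e assume "e \<in> set (diag_mat B)"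
    then have "poly (char_poly M) e = 0"
      unfolding char_poly_similar[OF sim] char_poly_upper_triangular[OF B ut]
      by (auto simp: poly_prod_list prod_list_zero_iff)
    then show "eigenvalue M e"
      using eigenvalue_root_char_poly[OF M] by simp
  next
    have "1\<^sub>m n - M = P * (1\<^sub>m n - B) * Q"
    proof -
      have "P * (1\<^sub>m n - B) * Q = (P * 1\<^sub>m n - P * B) * Q"
        using W by (subst mult_minus_distrib_mat[of _ n n]) auto
      also have "\<dots> = P * 1\<^sub>m n * Q - P * B * Q"
        using W by (subst minus_mult_distrib_mat[of _ n n]) auto
      also have "\<dots> = 1\<^sub>m n - M"
        using W by simp
      finally show ?thesis by simp
    qed
    then have "det (1\<^sub>m n - M) = det (P * (1\<^sub>m n - B)) * det Q"
      using W det_mult[of "P * (1\<^sub>m n - B)" n Q]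
      by (simp add: mult_carrier_mat[of _ n n] minus_carrier_mat)
    also have "det (P * (1\<^sub>m n - B)) = det P * det (1\<^sub>m n - B)"
      using W by (intro det_mult[of _ n]) auto
    also have "det P * det (1\<^sub>m n - B) * det Q = det (1\<^sub>m n - B) * (det P * det Q)"
      by simp
    also have "det P * det Q = 1"
      using W det_mult[of P n Q] by simp
    also have "det (1\<^sub>m n - B) * 1 = det (1\<^sub>m n - B)"
      by simp
    also have "\<dots> = prod_list (diag_mat (1\<^sub>m n - B))"
      using upper_triangularD[OF ut] B
      by (intro det_upper_triangular[of _ n] upper_triangularI) auto
    also have "diag_mat (1\<^sub>m n - B) = map (\<lambda>e. 1 - e) (diag_mat B)"
      using B by (auto simp: diag_mat_def)
    finally show "det (1\<^sub>m n - M) = (\<Prod>e\<leftarrow>diag_mat B. 1 - e)" .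
  next
    have "sum_list (diag_mat M) = sum_list (diag_mat (P * (B * Q)))"
      using W by simp
    also have "\<dots> = sum_list (diag_mat (B * Q * P))"
      using W by (intro sum_list_diag_mat_mult_commute) auto
    also have "B * Q * P = B"
      using W by (simp add: assoc_mult_mat[of _ n n _ n _ n])
    finally show "sum_list (diag_mat M) = sum_list (diag_mat B)" .
  qed
qed

text \<open>
  If \<open>A A\<^sup>T v = e v\<close>, then pairing with \<open>v\<close> gives \<open>e \<parallel>v\<parallel>\<^sup>2 = \<parallel>A\<^sup>T v\<parallel>\<^sup>2\<close>. The eigenvector is
  complex because the triangularisation takes place over \<open>\<complex>\<close>; in the order on complex numbers,
  the conclusion also says that \<open>e\<close> is real.
\<close>

lemma eigenvalue_gram_nonneg:
  fixes A :: "real mat"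
  assumes A: "A \<in> carrier_mat n k"
    and ev: "eigenvalue (map_mat complex_of_real (A * transpose_mat A)) e"
  shows "e \<ge> 0"
proof -
  define H where "H = map_mat complex_of_real A"
  have H: "H \<in> carrier_mat n k" using A by (simp add: H_def)
  have M: "map_mat complex_of_real (A * transpose_mat A) = H * transpose_mat H"
    unfolding H_def map_mat_transpose using A
    by (intro of_real_hom.mat_hom_mult[of _ n k _ n]) auto
  obtain v where v: "v \<in> carrier_vec n" "v \<noteq> 0\<^sub>v n" "(H * transpose_mat H) *\<^sub>v v = e \<cdot>\<^sub>v v"
    using ev H unfolding M eigenvalue_def eigenvector_def by auto
  define w where "w = transpose_mat H *\<^sub>v v"
  have w: "w \<in> carrier_vec k" using H v by (simp add: w_def)
  have conj: "conjugate w = transpose_mat H *\<^sub>v conjugate v"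
    using H v by (intro eq_vecI)
      (auto simp: w_def H_def scalar_prod_def sum_conjugate carrier_matD(1)[OF A] intro!: sum.cong)
  have "(H * transpose_mat H) *\<^sub>v v = H *\<^sub>v w"
    unfolding w_def using H v(1) by (intro assoc_mult_mat_vec[of _ n k _ n]) auto
  then have "H *\<^sub>v w = e \<cdot>\<^sub>v v"
    using v(3) by simp
  then have "e * (v \<bullet>c v) = (H *\<^sub>v w) \<bullet>c v"
    using v(1) by simp
  also have "\<dots> = conjugate v \<bullet> (H *\<^sub>v w)"
    using v H w by (intro comm_scalar_prod[of _ n]) auto
  also have "\<dots> = (transpose_mat H *\<^sub>v conjugate v) \<bullet> w"
    using v H w by (intro transpose_vec_mult_scalar[symmetric]) auto
  also have "\<dots> = w \<bullet>c w"
    unfolding conj[symmetric] using w by (intro comm_scalar_prod[of _ k]) auto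
  finally have eq: "e * (v \<bullet>c v) = w \<bullet>c w" .
  have "w \<bullet>c w \<ge> 0" "v \<bullet>c v > 0"
    using v by auto
  then obtain a b where "w \<bullet>c w = complex_of_real a" "a \<ge> 0" "v \<bullet>c v = complex_of_real b" "b > 0"
    by (metis (no_types, opaque_lifting) Reals_cases complex_is_real_iff_compare0 less_eq_complex_def
        less_complex_def order.strict_implies_order Re_complex_of_real zero_complex.sel(1))
  with eq have "e = complex_of_real (a / b)" "a / b \<ge> 0"
    by (auto simp: field_simps)
  then show ?thesis
    by (simp add: less_eq_complex_def)
qed

text \<open>
  Weierstrass' product inequality and its companion from \<open>1 - x \<le> exp (- x)\<close>, in the form needed
  for the list of eigenvalues.
\<close>

lemma one_minus_sum_list_le_prod_list:
  fixes xs :: "real list"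
  assumes "\<And>x. x \<in> set xs \<Longrightarrow> x \<ge> 0" "sum_list xs \<le> 1"
  shows "1 - sum_list xs \<le> (\<Prod>x\<leftarrow>xs. 1 - x)"
  using assms
proof (induction xs)
  case (Cons a xs)
  have nonneg: "a \<ge> 0" "sum_list xs \<ge> 0"
    using Cons.prems by (auto intro!: sum_list_nonneg)
  then have "1 - sum_list (a # xs) \<le> (1 - a) * (1 - sum_list xs)"
    by (simp add: algebra_simps)
  also have "\<dots> \<le> (1 - a) * (\<Prod>x\<leftarrow>xs. 1 - x)"
  proof (rule mult_left_mono)
    have "sum_list xs \<le> 1" "a \<le> 1"
      using Cons.prems(2) nonneg by simp_all
    then show "1 - sum_list xs \<le> (\<Prod>x\<leftarrow>xs. 1 - x)" "0 \<le> 1 - a"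
      using Cons.IH Cons.prems(1) by simp_all
  qed
  finally show ?case by simp
qed simp

lemma prod_list_one_minus_le_exp:
  fixes xs :: "real list"
  assumes "\<And>x. x \<in> set xs \<Longrightarrow> x \<le> 1"
  shows "(\<Prod>x\<leftarrow>xs. 1 - x) \<le> exp (- sum_list xs)"
proof -
  \<comment> \<open>The lower bound \<open>0\<close> is what allows the two factors to be multiplied in the induction.\<close>
  have "0 \<le> (\<Prod>x\<leftarrow>xs. 1 - x) \<and> (\<Prod>x\<leftarrow>xs. 1 - x) \<le> exp (- sum_list xs)"
    using assms
  proof (induction xs)
    case (Cons a xs)
    have "1 - a \<le> exp (- a)"
      using exp_ge_add_one_self[of "- a"] by simp
    then have "(1 - a) * (\<Prod>x\<leftarrow>xs. 1 - x) \<le> exp (- a) * exp (- sum_list xs)"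
      using Cons by (intro mult_mono) auto
    then show ?case using Cons by (simp add: exp_add[symmetric])
  qed simp
  then show ?thesis ..
qed

lemma frobenius_norm_power2:
  assumes "A \<in> carrier_mat n k"
  shows "(frobenius_norm A)\<^sup>2 = (\<Sum>i<n. \<Sum>j<k. (A $$ (i,j))\<^sup>2)"
  using assms by (auto simp: frobenius_norm_def L2_set_def sum.cartesian_product
      intro!: real_sqrt_pow2 sum_nonneg sum.cong)

lemma sum_list_diag_gram:
  fixes A :: "real mat"
  assumes "A \<in> carrier_mat n k"
  shows "sum_list (diag_mat (A * transpose_mat A)) = (frobenius_norm A)\<^sup>2"
  unfolding frobenius_norm_power2[OF assms] using assms
  by (auto simp: diag_mat_def scalar_prod_def interv_sum_list_conv_sum_set_nat
      atLeast0LessThan power2_eq_square intro!: sum.cong)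

text \<open>
  With \<open>\<lambda>\<^sub>i\<close> the eigenvalues of \<open>A A\<^sup>T\<close>, the determinant is \<open>\<Prod>(1 - \<lambda>\<^sub>i)\<close> and the squared
  Frobenius norm is the trace \<open>\<Sum>\<lambda>\<^sub>i\<close>. Two bounds on a product of numbers in \<open>[0, 1]\<close> by their
  sum thus take the place of an expansion of the determinant.
\<close>

lemma det_one_minus_gram_bounds:
  fixes A :: "real mat"
  assumes A: "A \<in> carrier_mat n k" and small: "(frobenius_norm A)\<^sup>2 \<le> 1"
  shows "1 - (frobenius_norm A)\<^sup>2 \<le> det (1\<^sub>m n - A * transpose_mat A)"
    and "det (1\<^sub>m n - A * transpose_mat A) \<le> exp (- (frobenius_norm A)\<^sup>2)"
proof -
  define G where "G = A * transpose_mat A"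
  have G: "G \<in> carrier_mat n n" using A by (simp add: G_def)
  have "map_mat complex_of_real G \<in> carrier_mat n n" using G by simp
  then obtain es where
    ev: "\<And>e. e \<in> set es \<Longrightarrow> eigenvalue (map_mat complex_of_real G) e" and
    det: "det (1\<^sub>m n - map_mat complex_of_real G) = (\<Prod>e\<leftarrow>es. 1 - e)" and
    tr: "sum_list (diag_mat (map_mat complex_of_real G)) = sum_list es"
    using complex_mat_eigenvalue_list by blast
  define xs where "xs = map Re es"
  have "e \<ge> 0" if "e \<in> set es" for e
    using eigenvalue_gram_nonneg[OF A] ev[OF that] by (simp add: G_def)
  then have re: "complex_of_real (Re e) = e" "Re e \<ge> 0" if "e \<in> set es" for e
    using that by (auto simp: less_eq_complex_def complex_eq_iff)
  then have es: "es = map complex_of_real xs"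
    unfolding xs_def map_map by (intro map_idI[symmetric]) simp
  have nonneg: "x \<ge> 0" if "x \<in> set xs" for x
    using re(2) that unfolding xs_def by auto
  have "complex_of_real (det (1\<^sub>m n - G)) = det (map_mat complex_of_real (1\<^sub>m n - G))"
    by simp
  also have "map_mat complex_of_real (1\<^sub>m n - G) = 1\<^sub>m n - map_mat complex_of_real G"
    using G by (intro eq_matI) auto
  also have "det \<dots> = complex_of_real (\<Prod>x\<leftarrow>xs. 1 - x)"
    unfolding det es by (induction xs) auto
  finally have det': "det (1\<^sub>m n - G) = (\<Prod>x\<leftarrow>xs. 1 - x)"
    using of_real_eq_iff by blast
  have "diag_mat (map_mat complex_of_real G) = map complex_of_real (diag_mat G)"
    using G by (auto simp: diag_mat_def)
  with tr es have "sum_list (map complex_of_real (diag_mat G)) = sum_list (map complex_of_real xs)"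
    by simp
  then have "complex_of_real (sum_list (diag_mat G)) = complex_of_real (sum_list xs)"
    unfolding of_real_hom.hom_sum_list .
  then have "sum_list (diag_mat G) = sum_list xs"
    using of_real_eq_iff by blast
  then have tr': "sum_list xs = (frobenius_norm A)\<^sup>2"
    using sum_list_diag_gram[OF A] unfolding G_def by simp
  have le1: "x \<le> 1" if "x \<in> set xs" for x
    using member_le_sum_list[OF that] nonneg small tr' by simp
  show "1 - (frobenius_norm A)\<^sup>2 \<le> det (1\<^sub>m n - A * transpose_mat A)"
    using one_minus_sum_list_le_prod_list[of xs] nonneg small tr' det' by (simp add: G_def)
  show "det (1\<^sub>m n - A * transpose_mat A) \<le> exp (- (frobenius_norm A)\<^sup>2)"
    using prod_list_one_minus_le_exp[of xs] le1 tr' det' by (simp add: G_def)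
qed

section \<open>Operator norm\<close>

lemma vec_norm2_power2: "(vec_norm2 v)\<^sup>2 = (\<Sum>i<dim_vec v. (vec_index v i)\<^sup>2)"
  by (auto simp: vec_norm2_def L2_set_def intro!: real_sqrt_pow2 sum_nonneg)

lemma vec_norm2_mult_mat_vec_le:
  assumes A: "A \<in> carrier_mat n k" and v: "v \<in> carrier_vec k"
  shows "vec_norm2 (A *\<^sub>v v) \<le> frobenius_norm A * vec_norm2 v"
proof (rule power2_le_imp_le)
  have "(vec_index (A *\<^sub>v v) i)\<^sup>2 \<le> (\<Sum>j<k. (A $$ (i,j))\<^sup>2) * (\<Sum>j<k. (vec_index v j)\<^sup>2)"
    if "i < n" for i
    using Cauchy_Schwarz_ineq_sum[of "\<lambda>j. A $$ (i,j)" "\<lambda>j. vec_index v j" "{..<k}"] A v that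
    by (simp add: scalar_prod_def atLeast0LessThan)
  then have "(\<Sum>i<n. (vec_index (A *\<^sub>v v) i)\<^sup>2)
      \<le> (\<Sum>i<n. (\<Sum>j<k. (A $$ (i,j))\<^sup>2) * (\<Sum>j<k. (vec_index v j)\<^sup>2))"
    by (intro sum_mono) auto
  then show "(vec_norm2 (A *\<^sub>v v))\<^sup>2 \<le> (frobenius_norm A * vec_norm2 v)\<^sup>2"
    using A v by (simp add: power_mult_distrib frobenius_norm_power2[OF A] vec_norm2_power2
        sum_distrib_right)
qed (simp add: frobenius_norm_def vec_norm2_def)

lemma frobenius_norm_transpose: "frobenius_norm (transpose_mat A) = frobenius_norm A"
proof -
  have "(frobenius_norm (transpose_mat A))\<^sup>2 = (frobenius_norm A)\<^sup>2"
    using frobenius_norm_power2[of A "dim_row A" "dim_col A"]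
      frobenius_norm_power2[of "transpose_mat A" "dim_col A" "dim_row A"]
      sum.swap[of "\<lambda>i j. (A $$ (i, j))\<^sup>2" "{..<dim_col A}" "{..<dim_row A}"]
    by simp
  then show ?thesis
    by (simp add: frobenius_norm_def power2_eq_iff_nonneg)
qed

text \<open>This puts small matrices inside the support of the density of the Haar block.\<close>

lemma mat_op_norm_gram_le:
  fixes A :: "real mat"
  assumes A: "A \<in> carrier_mat n k"
  shows "mat_op_norm (A * transpose_mat A) \<le> (frobenius_norm A)\<^sup>2"
  unfolding mat_op_norm_def
proof (rule cSUP_least)
  have "vec_norm2 (0\<^sub>v n) = 0" by (simp add: vec_norm2_def L2_set_def)
  then show "{v \<in> carrier_vec (dim_col (A * transpose_mat A)). vec_norm2 v \<le> 1} \<noteq> {}"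
    using A by (auto intro!: exI[of _ "0\<^sub>v n"])
next
  fix v assume "v \<in> {v \<in> carrier_vec (dim_col (A * transpose_mat A)). vec_norm2 v \<le> 1}"
  with A have v: "v \<in> carrier_vec n" and v1: "vec_norm2 v \<le> 1" by auto
  have F: "frobenius_norm A \<ge> 0" by (simp add: frobenius_norm_def)
  have "vec_norm2 (A * transpose_mat A *\<^sub>v v) = vec_norm2 (A *\<^sub>v (transpose_mat A *\<^sub>v v))"
    using A v by simp
  also have "\<dots> \<le> frobenius_norm A * vec_norm2 (transpose_mat A *\<^sub>v v)"
    using A v by (intro vec_norm2_mult_mat_vec_le) auto
  also have "\<dots> \<le> frobenius_norm A * (frobenius_norm A * vec_norm2 v)"
    using A v F vec_norm2_mult_mat_vec_le[of "transpose_mat A" k n v]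
    by (intro mult_left_mono) (auto simp: frobenius_norm_transpose)
  also have "\<dots> \<le> frobenius_norm A * (frobenius_norm A * 1)"
    using v1 F by (intro mult_left_mono) auto
  finally show "vec_norm2 (A * transpose_mat A *\<^sub>v v) \<le> (frobenius_norm A)\<^sup>2"
    by (simp add: power2_eq_square)
qed

section \<open>Ratios of Gamma values\<close>

text \<open>
  The slopes of the convex function \<open>ln \<circ> Gamma\<close> increase, and over an interval \<open>[x, x + 1]\<close> of
  length one the slope is exactly \<open>ln x\<close> by the functional equation. Comparing the slope over
  \<open>[y, y + s]\<close> with those over \<open>[y - 1, y]\<close> and \<open>[y + s, y + s + 1]\<close> bounds it on both sides.
\<close>

lemma ln_Gamma_increment_bounds:
  fixes y s :: real
  assumes y: "y > 1" and s: "s > 0"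
  shows "s * ln (y - 1) \<le> ln (Gamma (y + s)) - ln (Gamma y)"
    and "ln (Gamma (y + s)) - ln (Gamma y) \<le> s * ln (y + s)"
proof -
  let ?f = "ln \<circ> (Gamma :: real \<Rightarrow> real)"
  have step: "ln (Gamma (x + 1)) - ln (Gamma x) = ln x" if "x > 0" for x :: real
  proof -
    have "Gamma (x + 1) = x * Gamma x"
      using that by (intro Gamma_plus1) (auto elim: nonpos_Ints_cases)
    then show ?thesis using that by (simp add: ln_mult_pos Gamma_real_pos)
  qed
  have slope: "(?f b - ?f a) / (b - a) \<le> (?f c - ?f b) / (c - b)"
    if "0 < a" "a < b" "b < c" for a b c :: real
    using convex_on_slope_le[OF log_convex_Gamma_real, of a c b] that
    by (simp add: minus_divide_divide field_simps)
  have "ln (y - 1) \<le> (ln (Gamma (y + s)) - ln (Gamma y)) / s"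
    using slope[of "y - 1" y "y + s"] step[of "y - 1"] y s by simp
  then show "s * ln (y - 1) \<le> ln (Gamma (y + s)) - ln (Gamma y)"
    using s by (simp add: field_simps)
  have "(ln (Gamma (y + s)) - ln (Gamma y)) / s \<le> ln (y + s)"
    using slope[of y "y + s" "y + s + 1"] step[of "y + s"] y s by simp
  then show "ln (Gamma (y + s)) - ln (Gamma y) \<le> s * ln (y + s)"
    using s by (simp add: field_simps)
qed

lemma multi_Gamma_pos:
  assumes "x > (real m - 1) / 2"
  shows "multi_Gamma m x > 0"
  unfolding multi_Gamma_def using assms
  by (intro mult_pos_pos prod_pos Gamma_real_pos) (auto simp: field_simps)

lemma ln_multi_Gamma:
  assumes "x > (real m - 1) / 2"
  shows "ln (multi_Gamma m x) =
    real m * (real m - 1) / 4 * ln pi + (\<Sum>i=1..m. ln (Gamma (x - (real i - 1) / 2)))"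
proof -
  have pos: "Gamma (x - (real i - 1) / 2) > 0" if "i \<in> {1..m}" for i
    using assms that by (intro Gamma_real_pos) (auto simp: field_simps)
  have "ln (\<Prod>i=1..m. Gamma (x - (real i - 1) / 2)) = (\<Sum>i=1..m. ln (Gamma (x - (real i - 1) / 2)))"
    by (intro ln_prod less_imp_neq[OF pos, symmetric]) auto
  moreover have "(\<Prod>i=1..m. Gamma (x - (real i - 1) / 2)) > 0"
    using pos by (rule prod_pos)
  ultimately show ?thesis
    unfolding multi_Gamma_def by (simp add: ln_mult_pos ln_powr)
qed

text \<open>
  The powers of \<open>pi\<close> in the two multivariate Gamma functions cancel, and the remaining \<open>m\<close> quotients
  of Gamma values are estimated one at a time. The lower end \<open>y - 1\<close> of the bounds above equals
  \<open>(N/2) (1 - u)\<close> with \<open>u = (k + i + 1) / N \<le> 1/2\<close>, and the upper end \<open>y + k/2\<close> is at most \<open>N/2\<close>;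
  so the deviation from \<open>(k/2) ln (N/2)\<close> is one-sided.
\<close>

lemma ln_multi_Gamma_ratio_bound:
  fixes N m k :: nat
  assumes m: "m \<ge> 1" and k: "k \<ge> 1" and N: "2 * (m + k + 1) \<le> N"
  shows "\<bar>ln (multi_Gamma m (real N / 2)) - ln (multi_Gamma m ((real N - real k) / 2))
      - real m * real k / 2 * ln (real N / 2)\<bar>
    \<le> 2 * (real m * real k * (real m + real k) / real N)"
proof -
  define x where "x i = (real N - real k) / 2 - (real i - 1) / 2" for i
  define d where "d i = ln (Gamma (x i + real k / 2)) - ln (Gamma (x i))
    - real k / 2 * ln (real N / 2)" for i
  have N': "2 * (real m + real k + 1) \<le> real N"
    using of_nat_mono[OF N, where ?'a = real] by simp
  then have Npos: "real N > 0" using N by simp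
  have bound: "\<bar>d i\<bar> \<le> 2 * (real k * (real m + real k) / real N)" if i: "i \<in> {1..m}" for i
  proof -
    define u where "u = (real k + real i + 1) / real N"
    have i': "1 \<le> real i" "real i \<le> real m" using i by auto
    have x1: "x i > 1" using N' i' k by (simp add: x_def field_simps)
    have u: "0 \<le> u" "u \<le> 1 / 2"
      using N' i' Npos by (auto simp: u_def field_simps)
    have "u\<^sup>2 \<le> u / 2"
      using mult_left_mono[OF u(2) u(1)] by (simp add: power2_eq_square)
    then have "- 2 * u \<le> ln (1 - u)"
      using ln_one_minus_pos_lower_bound[OF u] by linarith
    moreover have "x i - 1 = real N / 2 * (1 - u)"
      using Npos by (simp add: x_def u_def field_simps)
    then have "ln (x i - 1) = ln (real N / 2) + ln (1 - u)"
      using ln_mult_pos[of "real N / 2" "1 - u"] u Npos by (simp only:)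
    ultimately have "ln (real N / 2) - 2 * u \<le> ln (x i - 1)"
      by linarith
    then have "real k / 2 * (ln (real N / 2) - 2 * u) \<le> real k / 2 * ln (x i - 1)"
      by (intro mult_left_mono) auto
    also have "\<dots> \<le> ln (Gamma (x i + real k / 2)) - ln (Gamma (x i))"
      using x1 k by (intro ln_Gamma_increment_bounds) auto
    finally have lower: "- (real k * u) \<le> d i"
      by (simp add: d_def algebra_simps)
    have "ln (Gamma (x i + real k / 2)) - ln (Gamma (x i)) \<le> real k / 2 * ln (x i + real k / 2)"
      using x1 k by (intro ln_Gamma_increment_bounds) auto
    also have "\<dots> \<le> real k / 2 * ln (real N / 2)"
      using x1 i' by (intro mult_left_mono) (auto simp: x_def field_simps)
    finally have upper: "d i \<le> 0"
      by (simp add: d_def)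
    \<comment> \<open>The surplus \<open>1\<close> in \<open>u\<close> is absorbed using \<open>m, k \<ge> 1\<close>.\<close>
    have "u \<le> 2 * ((real m + real k) / real N)"
      unfolding u_def times_divide_eq_right
      using i' k by (intro divide_right_mono) auto
    then have "real k * u \<le> 2 * (real k * (real m + real k) / real N)"
      using mult_left_mono[of u "2 * ((real m + real k) / real N)" "real k"]
      by (simp add: mult.left_commute)
    with lower upper show ?thesis by linarith
  qed
  have "(real m - 1) / 2 < (real N - real k) / 2" "(real m - 1) / 2 < real N / 2"
    using N' by auto
  then have "ln (multi_Gamma m (real N / 2)) - ln (multi_Gamma m ((real N - real k) / 2))
      - real m * real k / 2 * ln (real N / 2) = (\<Sum>i=1..m. d i)"
    by (simp add: ln_multi_Gamma d_def x_def sum_subtractf diff_divide_distrib algebra_simps)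
  also have "\<bar>\<dots>\<bar> \<le> (\<Sum>i=1..m. \<bar>d i\<bar>)" by (rule sum_abs)
  also have "\<dots> \<le> (\<Sum>i=1..m. 2 * (real k * (real m + real k) / real N))"
    using bound by (intro sum_mono)
  finally show ?thesis by (simp add: algebra_simps)
qed

section \<open>The logarithmic ratio of the densities\<close>

lemma frobenius_norm_smult: "frobenius_norm (c \<cdot>\<^sub>m A) = \<bar>c\<bar> * frobenius_norm A"
proof -
  have "frobenius_norm (c \<cdot>\<^sub>m A) = L2_set (\<lambda>ij. c * A $$ ij) ({..<dim_row A} \<times> {..<dim_col A})"
    unfolding frobenius_norm_def by (intro L2_set_cong) auto
  then show ?thesis
    by (simp add: frobenius_norm_def L2_set_def power_mult_distrib real_sqrt_mult
        flip: sum_distrib_left)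
qed

text \<open>
  The two parts of the estimate, normalising constants and determinant, meet here for a fixed
  matrix. Positivity of the ratio matters because the theorem uses the logarithm with
  \<open>ln 0 = - \<infinity>\<close>; it holds since \<open>D \<ge> 1 - t > 0\<close> and \<open>B / sqrt N\<close> lies inside the support.
\<close>

lemma ln_density_ratio_bound:
  fixes B :: "real mat"
  assumes B: "B \<in> carrier_mat m k" and m: "m \<ge> 1" and k: "k \<ge> 1"
    and N: "2 * (m + k + 1) \<le> N" and small: "2 * (frobenius_norm B)\<^sup>2 \<le> real N"
  shows "scaled_block_density N m k B / gaussian_density m k B > 0"
    and "\<bar>ln (scaled_block_density N m k B / gaussian_density m k B)\<bar>
      \<le> 2 * (frobenius_norm B ^ 4 / real N + real m * real k * (real m + real k) / real N
          + (real k + real m) * (frobenius_norm B)\<^sup>2 / real N)"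
proof -
  define A where "A = (1 / sqrt (real N)) \<cdot>\<^sub>m B"
  define t where "t = (frobenius_norm B)\<^sup>2 / real N"
  define D where "D = det (1\<^sub>m m - A * transpose_mat A)"
  define e where "e = (real N - real k - real m - 1) / 2"
  have N': "2 * (real m + real k + 1) \<le> real N"
    using of_nat_mono[OF N, where ?'a = real] by simp
  then have Npos: "real N > 0" using N by simp
  have A: "A \<in> carrier_mat m k" using B by (simp add: A_def)
  have At: "(frobenius_norm A)\<^sup>2 = t"
    using Npos by (simp add: A_def frobenius_norm_smult t_def power_mult_distrib power_divide)
  have t: "0 \<le> t" "t \<le> 1 / 2"
    using small Npos by (auto simp: t_def field_simps)
  have D: "1 - t \<le> D" "D \<le> exp (- t)"
    using det_one_minus_gram_bounds[OF A] t by (auto simp: At D_def)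
  have Dpos: "D > 0" using D t by linarith
  have "ln D \<le> - t"
    using D(2) Dpos by (metis ln_exp ln_le_cancel_iff exp_gt_zero)
  moreover have "- t - 2 * t\<^sup>2 \<le> ln D"
  proof -
    have "- t - 2 * t\<^sup>2 \<le> ln (1 - t)" by (rule ln_one_minus_pos_lower_bound[OF t])
    also have "\<dots> \<le> ln D" using D(1) t by simp
    finally show ?thesis .
  qed
  ultimately have lnD: "\<bar>ln D + t\<bar> \<le> 2 * t\<^sup>2" by linarith
  have op: "mat_op_norm (A * transpose_mat A) < 1"
    using mat_op_norm_gram_le[OF A] At t by simp
  define G1 G2 where "G1 = multi_Gamma m (real N / 2)"
    and "G2 = multi_Gamma m ((real N - real k) / 2)"
  have Gpos: "G1 > 0" "G2 > 0"
    unfolding G1_def G2_def using N' by (auto intro!: multi_Gamma_pos)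
  define r where "r = real m * real k / 2"
  have S: "scaled_block_density N m k B = real N powr (- r) * (G1 / (pi powr r * G2) * D powr e)"
    using op by (simp add: scaled_block_density_def haar_block_density_def A_def D_def e_def
        G1_def G2_def r_def)
  have Spos: "scaled_block_density N m k B > 0"
    unfolding S using Gpos Dpos Npos by simp
  have Pos: "gaussian_density m k B > 0"
    by (simp add: gaussian_density_def)
  show "scaled_block_density N m k B / gaussian_density m k B > 0"
    using Spos Pos by simp
  have "ln (scaled_block_density N m k B) = - r * ln N + (ln G1 - (r * ln pi + ln G2)) + e * ln D"
    unfolding S using Gpos Dpos Npos by (simp add: ln_mult_pos ln_div ln_powr)
  moreover have "ln (gaussian_density m k B) = - r * (ln 2 + ln pi) - real N * t / 2"
    unfolding gaussian_density_def using Npos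
    by (simp add: ln_mult_pos ln_powr r_def t_def)
  ultimately have "ln (scaled_block_density N m k B / gaussian_density m k B)
      = (ln G1 - ln G2 - r * ln (real N / 2)) + (e * ln D + real N * t / 2)"
    using Spos Pos Npos by (simp add: ln_div algebra_simps)
  \<comment> \<open>Since \<open>2 e = N - (k + m + 1)\<close>, the terms of order \<open>N t\<close> cancel.\<close>
  also have "e * ln D + real N * t / 2 = e * (ln D + t) + (real k + real m + 1) * t / 2"
    by (simp add: e_def field_simps)
  finally have ratio: "ln (scaled_block_density N m k B / gaussian_density m k B)
      = (ln G1 - ln G2 - r * ln (real N / 2)) + e * (ln D + t) + (real k + real m + 1) * t / 2"
    by simp
  have "\<bar>e * (ln D + t)\<bar> \<le> real N / 2 * (2 * t\<^sup>2)"
    unfolding abs_mult using lnD N' by (intro mult_mono) (auto simp: e_def)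
  also have "\<dots> = frobenius_norm B ^ 4 / real N"
    using Npos by (simp add: t_def power2_eq_square power4_eq_xxxx field_simps)
  finally have 1: "\<bar>e * (ln D + t)\<bar> \<le> frobenius_norm B ^ 4 / real N" .
  have "(real k + real m + 1) * t / 2 \<le> (real k + real m) * t"
    using m k t mult_right_mono[of 1 "real k + real m" t] by (simp add: algebra_simps)
  then have 2: "\<bar>(real k + real m + 1) * t / 2\<bar>
      \<le> (real k + real m) * (frobenius_norm B)\<^sup>2 / real N"
    using t by (simp add: t_def)
  have 3: "\<bar>ln G1 - ln G2 - r * ln (real N / 2)\<bar>
      \<le> 2 * (real m * real k * (real m + real k) / real N)"
    using ln_multi_Gamma_ratio_bound[OF m k N] by (simp add: G1_def G2_def r_def)
  have "\<bar>ln (scaled_block_density N m k B / gaussian_density m k B)\<bar>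
      \<le> 2 * (real m * real k * (real m + real k) / real N) + frobenius_norm B ^ 4 / real N
        + (real k + real m) * (frobenius_norm B)\<^sup>2 / real N"
    unfolding ratio by (intro order_trans[OF abs_triangle_ineq] add_mono 1 2 3)
  also have "\<dots> \<le> 2 * (real m * real k * (real m + real k) / real N)
      + 2 * (frobenius_norm B ^ 4 / real N)
      + 2 * ((real k + real m) * (frobenius_norm B)\<^sup>2 / real N)"
  proof -
    have double: "x \<le> 2 * x" if "0 \<le> x" for x :: real
      using that by simp
    show ?thesis
      by (intro add_mono order.refl double) auto
  qed
  finally show "\<bar>ln (scaled_block_density N m k B / gaussian_density m k B)\<bar>
      \<le> 2 * (frobenius_norm B ^ 4 / real N + real m * real k * (real m + real k) / real N
          + (real k + real m) * (frobenius_norm B)\<^sup>2 / real N)"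
    by (simp only: distrib_left add.commute add.left_commute)
qed

theorem proposition2p3:
  fixes m k :: "nat \<Rightarrow> nat" and R :: "nat \<Rightarrow> real"
  assumes "\<And>N. m N \<ge> 1" and "\<And>N. k N \<ge> 1"
    and "(\<lambda>N. real (m N)) \<in> o(\<lambda>N. real N)"
    and "(\<lambda>N. real (k N)) \<in> o(\<lambda>N. real N)"
    and "\<And>N. R N \<ge> 0"
    and "R \<in> o(\<lambda>N. real N powr (1 / 2))"
  shows "\<exists>C>0. \<forall>\<^sub>F N in sequentially.
    (SUP B \<in> {B \<in> carrier_mat (m N) (k N). frobenius_norm B \<le> R N}.
        \<bar>ext_ln (scaled_block_density N (m N) (k N) B / gaussian_density (m N) (k N) B)\<bar>)
      \<le> ereal (C * (R N ^ 4 / real N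
                   + real (m N) * real (k N) * (real (m N) + real (k N)) / real N
                   + (real (k N) + real (m N)) * (R N)\<^sup>2 / real N))"
proof (intro exI[of _ "2 :: real"] conjI)
  \<comment> \<open>\<open>m\<close> and \<open>k\<close> at most \<open>N / 8\<close> each, with \<open>N \<ge> 4\<close>, leave room for \<open>2 (m + k + 1) \<le> N\<close>.\<close>
  have "\<forall>\<^sub>F N in sequentially. norm (real (m N)) \<le> 1 / 8 * norm (real N)"
    using assms(3) by (rule landau_o.smallD) auto
  moreover have "\<forall>\<^sub>F N in sequentially. norm (real (k N)) \<le> 1 / 8 * norm (real N)"
    using assms(4) by (rule landau_o.smallD) auto
  moreover have "\<forall>\<^sub>F N in sequentially. norm (R N) \<le> 1 / 2 * norm (real N powr (1 / 2))"
    using assms(6) by (rule landau_o.smallD) auto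
  moreover have "\<forall>\<^sub>F N in sequentially. 4 \<le> N"
    by (rule eventually_ge_at_top)
  ultimately show "\<forall>\<^sub>F N in sequentially.
    (SUP B \<in> {B \<in> carrier_mat (m N) (k N). frobenius_norm B \<le> R N}.
        \<bar>ext_ln (scaled_block_density N (m N) (k N) B / gaussian_density (m N) (k N) B)\<bar>)
      \<le> ereal (2 * (R N ^ 4 / real N
                   + real (m N) * real (k N) * (real (m N) + real (k N)) / real N
                   + (real (k N) + real (m N)) * (R N)\<^sup>2 / real N))"
  proof eventually_elim
    case (elim N)
    have N: "2 * (m N + k N + 1) \<le> N"
      using elim by simp
    have R: "2 * (R N)\<^sup>2 \<le> real N"
    proof -
      have "R N \<le> 1 / 2 * sqrt (real N)"
        using elim assms(5)[of N] by (simp add: powr_half_sqrt)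
      then have "(R N)\<^sup>2 \<le> (1 / 2 * sqrt (real N))\<^sup>2"
        using assms(5) by (intro power_mono) auto
      then show ?thesis by (simp add: power_mult_distrib power_divide)
    qed
    show ?case
    proof (rule SUP_least)
      fix B assume "B \<in> {B \<in> carrier_mat (m N) (k N). frobenius_norm B \<le> R N}"
      then have B: "B \<in> carrier_mat (m N) (k N)" and BR: "frobenius_norm B \<le> R N" by auto
      have B0: "frobenius_norm B \<ge> 0" by (simp add: frobenius_norm_def)
      have pow: "frobenius_norm B ^ n \<le> R N ^ n" for n
        using BR B0 by (intro power_mono)
      have small: "2 * (frobenius_norm B)\<^sup>2 \<le> real N"
        using pow[of 2] R by linarith
      note ratio = ln_density_ratio_bound[OF B assms(1,2) N small]
      note ratio(2)
      also have "2 * (frobenius_norm B ^ 4 / real N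
            + real (m N) * real (k N) * (real (m N) + real (k N)) / real N
            + (real (k N) + real (m N)) * (frobenius_norm B)\<^sup>2 / real N)
          \<le> 2 * (R N ^ 4 / real N
            + real (m N) * real (k N) * (real (m N) + real (k N)) / real N
            + (real (k N) + real (m N)) * (R N)\<^sup>2 / real N)"
        using pow by (intro mult_left_mono add_mono divide_right_mono order.refl) auto
      finally show "\<bar>ext_ln (scaled_block_density N (m N) (k N) B / gaussian_density (m N) (k N) B)\<bar>
          \<le> ereal (2 * (R N ^ 4 / real N
            + real (m N) * real (k N) * (real (m N) + real (k N)) / real N
            + (real (k N) + real (m N)) * (R N)\<^sup>2 / real N))"
        using ratio(1) by (simp add: ext_ln_def)
    qed
  qed
qed simp

end
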